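(* Let $n\ge1$ be an integer and $0<a<b$. Let $\lambda^*=\sup_{m\in\mathcal M_{\rm all}}\inf_{\mathbf F\in\mathcal F_{\rm iid}}\mathrm{Ratio}(m,\mathbf F)\in(0,1]$ be the maximin ratio, and let $k_l(\lambda^*,n)\in(0,1)$ be the threshold defined in the context with $\lambda=\lambda^*$. Then $a/b>k_l(\lambda^*,n)$; that is, the maximin ratio problem is never in the regime $a/b\le k_l$ in which a pure second-price auction with random reserve is the optimal mechanism for minimax $\lambda^*$-regret.
   Context: Setting. A seller sells one item to $n$ buyers with valuations $\mathbf v\in[a,b]^n$. A mechanism is $m=(\mathbf x,\mathbf p)$ with (Borel measurable) allocation $\mathbf x:[a,b]^n\to[0,1]^n$ and payment $\mathbf p:[a,b]^n\to\mathbb R^n$. $\mathcal M_{\rm all}$ is the class of all mechanisms such that for all $i,v_i,\hat v_i,\mathbf v_{-i}$: $v_ix_i(\mathbf v)-p_i(\mathbf v)\ge0$; $v_ix_i(v_i,\mathbf v_{-i})-p_i(v_i,\mathbf v_{-i})\ge v_ix_i(\hat v_i,\mathbf v_{-i})-p_i(\hat v_i,\mathbf v_{-i})$; $\sum_ix_i(\mathbf v)\le1$. $\mathcal F_{\rm iid}$ is the class of product distributions $\prod_iF(v_i)$ with $F$ an arbitrary probability distribution supported in $[a,b]$. $\mathrm{Ratio}(m,\mathbf F)=\mathbb E_{\mathbf v\sim\mathbf F}[\sum_ip_i(\mathbf v)]/\mathbb E_{\mathbf v\sim\mathbf F}[\max(\mathbf v)]$. For $\lambda\in(0,1]$, $k_l=k_l(\lambda,n)\in(0,1)$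 is the unique solution in $(0,1)$ of $\lambda\int_{k_l}^1\frac{(t-k_l)^{n-1}}{t^n}dt=(1-k_l)^{n-1}$. In the minimax $\lambda$-regret problem $\inf_{m\in\mathcal M_{\rm all}}\sup_{\mathbf F\in\mathcal F_{\rm iid}}\mathbb E_{\mathbf v\sim\mathbf F}[\lambda\max(\mathbf v)-\sum_ip_i(\mathbf v)]$, the "pure SPA regime" is by definition $a/b\le k_l(\lambda,n)$; the maximin ratio objective corresponds to $\lambda=\lambda^*$. *)

theory Defs
  imports "HOL-Probability.Probability"
begin

text \<open>
  The buyers are \<open>0, \<dots>, n - 1\<close>.  A valuation profile is an extensional function on \<open>{..<n}\<close>, so
  that the product measures below live exactly on the set of profiles \<open>[a,b]\<^sup>n\<close>.
\<close>

definition profiles :: "nat \<Rightarrow> real \<Rightarrow> real \<Rightarrow> (nat \<Rightarrow> real) set" where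
  "profiles n a b = ({..<n} \<rightarrow>\<^sub>E {a..b})"

definition profile_space :: "nat \<Rightarrow> real \<Rightarrow> real \<Rightarrow> (nat \<Rightarrow> real) measure" where
  "profile_space n a b = Pi\<^sub>M {..<n} (\<lambda>_. restrict_space borel {a..b})"

text \<open>A mechanism is a pair \<open>(x, p)\<close> of allocation and payment rules, \<open>x v i\<close> and \<open>p v i\<close> being the
  values for buyer \<open>i\<close> at profile \<open>v\<close>.  Values outside \<open>[a,b]\<^sup>n\<close> or at indices \<open>i \<ge> n\<close> are irrelevant.\<close>

type_synonym mechanism = "((nat \<Rightarrow> real) \<Rightarrow> nat \<Rightarrow> real) \<times> ((nat \<Rightarrow> real) \<Rightarrow> nat \<Rightarrow> real)"

definition is_mechanism :: "nat \<Rightarrow> real \<Rightarrow> real \<Rightarrow> mechanism \<Rightarrow> bool" where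
  "is_mechanism n a b = (\<lambda>(x, p).
     (\<forall>i<n. (\<lambda>v. x v i) \<in> borel_measurable (profile_space n a b)) \<and>
     (\<forall>i<n. (\<lambda>v. p v i) \<in> borel_measurable (profile_space n a b)) \<and>
     (\<forall>v\<in>profiles n a b. \<forall>i<n. x v i \<in> {0..1}))"

definition individually_rational :: "nat \<Rightarrow> real \<Rightarrow> real \<Rightarrow> mechanism \<Rightarrow> bool" where
  "individually_rational n a b = (\<lambda>(x, p).
     \<forall>v\<in>profiles n a b. \<forall>i<n. v i * x v i - p v i \<ge> 0)"

definition incentive_compatible :: "nat \<Rightarrow> real \<Rightarrow> real \<Rightarrow> mechanism \<Rightarrow> bool" where
  "incentive_compatible n a b = (\<lambda>(x, p).
     \<forall>v\<in>profiles n a b. \<forall>i<n. \<forall>w\<in>{a..b}.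
       v i * x v i - p v i \<ge> v i * x (v(i := w)) i - p (v(i := w)) i)"

definition feasible :: "nat \<Rightarrow> real \<Rightarrow> real \<Rightarrow> mechanism \<Rightarrow> bool" where
  "feasible n a b = (\<lambda>(x, p). \<forall>v\<in>profiles n a b. (\<Sum>i<n. x v i) \<le> 1)"

definition M_all :: "nat \<Rightarrow> real \<Rightarrow> real \<Rightarrow> mechanism set" where
  "M_all n a b = {m. is_mechanism n a b m \<and> individually_rational n a b m \<and>
                     incentive_compatible n a b m \<and> feasible n a b m}"

definition F_iid :: "nat \<Rightarrow> real \<Rightarrow> real \<Rightarrow> (nat \<Rightarrow> real) measure set" where
  "F_iid n a b = {Pi\<^sub>M {..<n} (\<lambda>_. F) | F.
     prob_space F \<and> sets F = sets (restrict_space borel {a..b})}"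

text \<open>
  Expectation with values in the extended reals.  The constraints bound payments above but not below,
  so the expected revenue may be \<open>-\<infinity>\<close>, whereas the Bochner integral would then return \<open>0\<close>.  The
  indeterminate case \<open>\<infinity> - \<infinity>\<close> cannot occur for an integrand bounded above.
\<close>

definition ext_expectation :: "'a measure \<Rightarrow> ('a \<Rightarrow> real) \<Rightarrow> ereal" where
  "ext_expectation M f =
     enn2ereal (\<integral>\<^sup>+ v. ennreal (f v) \<partial>M) - enn2ereal (\<integral>\<^sup>+ v. ennreal (- f v) \<partial>M)"

definition Ratio :: "nat \<Rightarrow> mechanism \<Rightarrow> (nat \<Rightarrow> real) measure \<Rightarrow> ereal" where
  "Ratio n m F =
     ext_expectation F (\<lambda>v. \<Sum>i<n. snd m v i) / ext_expectation F (\<lambda>v. Max (v ` {..<n}))"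

definition maximin_ratio :: "nat \<Rightarrow> real \<Rightarrow> real \<Rightarrow> ereal" where
  "maximin_ratio n a b = (SUP m\<in>M_all n a b. INF F\<in>F_iid n a b. Ratio n m F)"

definition k_l :: "real \<Rightarrow> nat \<Rightarrow> real" where
  "k_l lam n = (THE k. k \<in> {0<..<1} \<and>
     lam * integral {k..1} (\<lambda>t. (t - k) ^ (n - 1) / t ^ n) = (1 - k) ^ (n - 1))"

end

(* The substitution t = k / u turns the integral defining k_l into J(k), the integral of
   (1 - u)^(n-1) / u over [k, 1], and J(k) / (1 - k)^(n-1) is strictly decreasing in k.  Hence
   k_l(lam) < c, with c = a / b, amounts to lam J(c) < (1 - c)^(n-1).  For lam the maximin ratio this
   follows from testing every mechanism against i.i.d. equal-revenue values (tail a / t on [a, b),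
   an atom of mass c at b).  With R = 1 - (1 - c)^n, the probability that some value is b, no
   mechanism earns more than b R, whereas the expected maximum is at least b R + n a J(c), the second
   term coming from profiles with a unique maximum below b.  Finally
   R J(c) / (R + n c J(c)) < (1 - c)^(n-1) follows from n c J(c) <= (1 - c)^n and Bernoulli's
   inequality R <= n c. *)

theory Submission
  imports Defs
begin

subsection \<open>The threshold equation\<close>

text \<open>The J(k) of the overview. Unlike the integrand of the threshold equation, this one is
  independent of \<open>k\<close>, which enters only as a limit of integration; the derivative in
  \<open>k\<close> is then immediate.\<close>

definition spa_integral :: "nat \<Rightarrow> real \<Rightarrow> real" where
  "spa_integral n k = integral {k..1} (\<lambda>u. (1 - u) ^ (n - 1) / u)"

lemma continuous_on_spa_integrand:
  "0 < k \<Longrightarrow> continuous_on {k..l} (\<lambda>u::real. (1 - u) ^ m / u)"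
  by (auto intro!: continuous_intros)

lemma spa_integral_nonneg: "0 < k \<Longrightarrow> 0 \<le> spa_integral n k"
  unfolding spa_integral_def
  by (rule integral_nonneg) (auto intro!: integrable_continuous_real continuous_on_spa_integrand)

lemma integral_eq_spa_integral:
  assumes "1 \<le> n" and k: "0 < k" "k < 1"
  shows "integral {k..1} (\<lambda>t. (t - k) ^ (n - 1) / t ^ n) = spa_integral n k"
proof -
  let ?f = "\<lambda>u::real. (1 - u) ^ (n - 1) / u"
  \<comment> \<open>The substitution \<open>u = k / t\<close> reverses orientation: the first
    integral runs over the empty interval from \<open>1\<close> to \<open>k\<close>, so the
    difference is \<open>- spa_integral n k\<close>.\<close>
  have "((\<lambda>t. (- k / t\<^sup>2) *\<^sub>R ?f (k / t)) has_integral
      (integral {k / k..k / 1} ?f - integral {k / 1..k / k} ?f)) {k..1}"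
  proof (rule has_integral_substitution_general[where s = "{}" and c = k and d = 1])
    show "(\<lambda>t. k / t) ` {k..1} \<subseteq> {k..1}"
      using k by (auto simp: field_simps mult_left_le)
    show "((\<lambda>t. k / t) has_real_derivative - k / x\<^sup>2) (at x within {k..1})" if "x \<in> {k..1} - {}" for x
      using that k by (auto intro!: derivative_eq_intros simp: power2_eq_square)
  qed (use k in \<open>auto intro!: continuous_intros\<close>)
  then have "((\<lambda>t. (- k / t\<^sup>2) *\<^sub>R ?f (k / t)) has_integral - spa_integral n k) {k..1}"
    using k by (simp add: spa_integral_def)
  from has_integral_neg[OF this]
  have "((\<lambda>t. - ((- k / t\<^sup>2) *\<^sub>R ?f (k / t))) has_integral spa_integral n k) {k..1}"
    by simp
  moreover have "- ((- k / t\<^sup>2) *\<^sub>R ?f (k / t)) = (t - k) ^ (n - 1) / t ^ n" if "t \<in> {k..1}" for t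
  proof -
    have t: "t > 0" using that k by auto
    have "1 - k / t = (t - k) / t" using t by (simp add: field_simps)
    moreover obtain m where "n = Suc m" using assms(1) by (cases n) auto
    ultimately show ?thesis
      using t k by (simp add: power_divide power2_eq_square)
  qed
  ultimately have "((\<lambda>t. (t - k) ^ (n - 1) / t ^ n) has_integral spa_integral n k) {k..1}"
    using has_integral_cong[of "{k..1}" "\<lambda>t. - ((- k / t\<^sup>2) *\<^sub>R ?f (k / t))"] by (metis (lifting))
  then show ?thesis by (rule integral_unique)
qed

text \<open>On \<open>[k, 1]\<close> one has \<open>1 / u \<le> 1 / k\<close>, and the integral of
  \<open>(1 - u) ^ (n - 1)\<close> over that interval is \<open>(1 - k) ^ n / n\<close>.\<close>

lemma spa_integral_upper:
  assumes "1 \<le> n" and k: "0 < k" "k < 1"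
  shows "n * k * spa_integral n k \<le> (1 - k) ^ n"
proof -
  obtain m where n: "n = Suc m" using assms(1) by (cases n) auto
  have "((\<lambda>u. (1 - u) ^ m / k) has_integral - ((1 - 1) ^ n / (n * k)) - - ((1 - k) ^ n / (n * k))) {k..1}"
  proof (rule fundamental_theorem_of_calculus)
    fix x assume "x \<in> {k..1}"
    have "((\<lambda>u::real. (1 - u) ^ Suc m) has_real_derivative (1 + real m) * (- 1 * (1 - x) ^ m))
        (at x within {k..1})"
      by (rule DERIV_power_Suc) (auto intro!: derivative_eq_intros)
    from DERIV_cdivide[OF DERIV_minus[OF this], of "n * k"]
    show "((\<lambda>u. - ((1 - u) ^ n / (n * k))) has_vector_derivative (1 - x) ^ m / k) (at x within {k..1})"
      unfolding has_real_derivative_iff_has_vector_derivative[symmetric]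
      by (rule DERIV_cong[THEN has_field_derivative_transform_within, of _ _ _ _ _ 1])
         (use k n \<open>x \<in> {k..1}\<close> in \<open>auto simp: divide_simps\<close>)
  qed (use k in auto)
  then have *: "((\<lambda>u. (1 - u) ^ m / k) has_integral (1 - k) ^ n / (n * k)) {k..1}"
    by (simp add: n)
  have "spa_integral n k \<le> (1 - k) ^ n / (n * k)"
    unfolding spa_integral_def
  proof (rule integral_le[THEN order_trans])
    show "(\<lambda>u. (1 - u) ^ (n - 1) / u) integrable_on {k..1}"
      using k by (intro integrable_continuous_real continuous_on_spa_integrand)
    show "integral {k..1} (\<lambda>u. (1 - u) ^ m / k) \<le> (1 - k) ^ n / (n * k)"
      by (rule integral_unique[OF *, THEN eq_refl])
  qed (use * k n in \<open>auto intro!: divide_left_mono\<close>)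
  then show ?thesis using assms by (simp add: field_simps)
qed

lemma has_real_derivative_spa_integral:
  assumes "0 < k" "k < 1"
  shows "(spa_integral n has_real_derivative - ((1 - k) ^ (n - 1) / k)) (at k)"
proof -
  \<comment> \<open>Starting the interval at \<open>k/2\<close> makes \<open>k\<close> an interior
    point, so the derivative within the interval is the full derivative.\<close>
  have "(spa_integral n has_real_derivative - ((1 - k) ^ (n - 1) / k)) (at k within {k/2..1})"
    unfolding spa_integral_def[abs_def]
    using integral_has_real_derivative'[OF continuous_on_spa_integrand, of "k/2" k 1 "n - 1"] assms by simp
  then show ?thesis
    using assms by (simp add: at_within_Icc_at)
qed

text \<open>With \<open>m = n - 1\<close>, the quotient rule gives a derivative with the sign of
  \<open>x * m * J(x) - (1 - x) ^ n\<close>. This is negative because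
  \<open>spa_integral_upper\<close> bounds \<open>x * n * J(x)\<close> by \<open>(1 - x) ^ n\<close>
  and \<open>m < n\<close>.\<close>

lemma spa_ratio_strict_decreasing:
  assumes n: "1 \<le> n" and kl: "0 < k" "k < l" "l < 1"
  shows "spa_integral n l / (1 - l) ^ (n - 1) < spa_integral n k / (1 - k) ^ (n - 1)"
proof (rule DERIV_neg_imp_decreasing[OF kl(2)])
  fix x assume x: "k \<le> x" "x \<le> l"
  with kl have x01: "0 < x" "x < 1" by auto
  let ?J = "spa_integral n x"
  obtain m where m: "n = Suc m" using n by (cases n) auto
  have "((\<lambda>x. spa_integral n x / (1 - x) ^ m) has_real_derivative
     (- ((1 - x) ^ m / x) * (1 - x) ^ m + ?J * (m * (1 - x) ^ (m - 1))) / ((1 - x) ^ m)\<^sup>2) (at x)"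
    using x01 has_real_derivative_spa_integral[of x n] m
    by (auto intro!: derivative_eq_intros simp: power2_eq_square)
  moreover have "- ((1 - x) ^ m / x) * (1 - x) ^ m + ?J * (m * (1 - x) ^ (m - 1)) < 0"
  proof (cases m)
    case 0 then show ?thesis using x01 by simp
  next
    case (Suc j)
    have "x * m * ?J < (1 - x) ^ n"
    proof -
      have "x * n * ?J \<le> (1 - x) ^ n" using spa_integral_upper[OF n x01] by (simp add: mult_ac)
      moreover have "x * m * ?J < x * n * ?J" if "0 < ?J"
        using that x01 m by (intro mult_strict_right_mono mult_strict_left_mono) auto
      moreover have "0 < (1 - x) ^ n" "0 \<le> ?J" using x01 spa_integral_nonneg[of x n] by auto
      ultimately show ?thesis by (cases "?J = 0") auto
    qed
    then have "(x * m * ?J) * (1 - x) ^ j < (1 - x) ^ n * (1 - x) ^ j"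
      using x01 by (intro mult_strict_right_mono) auto
    then have "?J * (m * (1 - x) ^ (m - 1)) < (1 - x) ^ m / x * (1 - x) ^ m"
      using x01 by (simp add: m Suc field_simps)
    then show ?thesis by simp
  qed
  ultimately show "\<exists>y. ((\<lambda>x. spa_integral n x / (1 - x) ^ (n - 1)) has_real_derivative y) (at x) \<and> y < 0"
    using x01 m by (intro exI conjI) (auto simp: divide_neg_pos)
qed

text \<open>Up to \<open>1/2\<close> the factor \<open>(1 - u) ^ (n - 1)\<close> is at least
  \<open>(1/2) ^ (n - 1)\<close>, which leaves a logarithm. Its divergence as \<open>k\<close> tends
  to \<open>0\<close> yields a point where the threshold ratio reaches
  \<open>1 / lam\<close>.\<close>

lemma spa_integral_lower:
  assumes k: "0 < k" "k \<le> 1/2"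
  shows "(1/2) ^ (n - 1) * (ln (1/2) - ln k) \<le> spa_integral n k"
proof -
  have *: "((\<lambda>u. (1/2) ^ (n - 1) * (1 / u)) has_integral (1/2) ^ (n - 1) * (ln (1/2) - ln k)) {k..1/2}"
    using k by (intro has_integral_mult_right fundamental_theorem_of_calculus)
      (auto intro!: derivative_eq_intros simp: has_real_derivative_iff_has_vector_derivative[symmetric])
  have "(1/2) ^ (n - 1) * (ln (1/2) - ln k) \<le> integral {k..1/2} (\<lambda>u. (1 - u) ^ (n - 1) / u)"
    unfolding integral_unique[OF *, symmetric]
  proof (rule integral_le)
    show "(1/2) ^ (n - 1) * (1 / u) \<le> (1 - u) ^ (n - 1) / u" if "u \<in> {k..1/2}" for u :: real
      using that k power_mono[of "1/2" "1 - u" "n - 1"] by (auto intro!: divide_right_mono)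
    show "(\<lambda>u. (1/2) ^ (n - 1) * (1 / u)) integrable_on {k..1/2}"
      using * by blast
  qed (use k in \<open>auto intro!: integrable_continuous_real continuous_on_spa_integrand\<close>)
  also have "\<dots> \<le> spa_integral n k"
    unfolding spa_integral_def using k
    by (intro integral_subset_le) (auto intro!: integrable_continuous_real continuous_on_spa_integrand)
  finally show ?thesis .
qed

text \<open>The hypothesis puts the ratio \<open>?g\<close> below \<open>1 / lam\<close> at
  \<open>c\<close>, while near \<open>0\<close> it is at least \<open>1 / lam\<close>. The
  intermediate value theorem gives a root below \<open>c\<close>; strict monotonicity makes it the
  only one in \<open>(0, 1)\<close>, so the definite description denotes it.\<close>

lemma k_l_less:
  assumes n: "1 \<le> n" and lam: "0 < lam" and c: "0 < c" "c < 1"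
    and less: "lam * spa_integral n c < (1 - c) ^ (n - 1)"
  shows "k_l lam n < c"
proof -
  let ?g = "\<lambda>k. spa_integral n k / (1 - k) ^ (n - 1)"
  have eq_iff: "lam * integral {k..1} (\<lambda>t. (t - k) ^ (n - 1) / t ^ n) = (1 - k) ^ (n - 1) \<longleftrightarrow>
      ?g k = 1 / lam" if "k \<in> {0<..<1}" for k
    using that integral_eq_spa_integral[OF n, of k] lam by (auto simp: field_simps)
  \<comment> \<open>The second entry makes the logarithmic lower bound of
    \<open>spa_integral n e\<close> at least \<open>1 / lam\<close> and keeps
    \<open>e \<le> 1/2\<close>; the entry \<open>c / 2\<close> keeps \<open>e < c\<close>.\<close>
  define e where "e = min (c / 2) (exp (ln (1/2) - 2 ^ (n - 1) / lam))"
  have "exp (ln (1/2) - 2 ^ (n - 1) / lam) \<le> exp (ln (1/2::real))"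
    using lam by (subst exp_le_cancel_iff) simp
  then have e: "0 < e" "e < c" "e < 1" "e \<le> 1/2" using c by (auto simp: e_def)
  have "ln e \<le> ln (1/2) - 2 ^ (n - 1) / lam"
    using e by (intro ln_le_cancel_iff[THEN iffD2, of e "exp _", simplified]) (auto simp: e_def)
  then have "2 ^ (n - 1) / lam \<le> ln (1/2) - ln e" by simp
  then have "(1/2) ^ (n - 1) * (2 ^ (n - 1) / lam) \<le> (1/2) ^ (n - 1) * (ln (1/2) - ln e)"
    by (intro mult_left_mono) auto
  also have "\<dots> \<le> spa_integral n e" by (rule spa_integral_lower) (use e in auto)
  finally have "1 / lam \<le> spa_integral n e"
    by (simp add: power_divide)
  also have "\<dots> \<le> ?g e"
    using e spa_integral_nonneg[of e n] power_le_one[of "1 - e" "n - 1"]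
    by (simp add: pos_le_divide_eq mult_left_le)
  finally have "1 / lam \<le> ?g e" .
  moreover have gc: "?g c < 1 / lam" using less lam c by (simp add: field_simps)
  moreover have "isCont ?g x" if "e \<le> x" "x \<le> c" for x
    using that e c DERIV_isCont[OF has_real_derivative_spa_integral[of x n]]
    by (auto intro!: continuous_intros)
  ultimately obtain k where k: "e \<le> k" "k \<le> c" "?g k = 1 / lam"
    using IVT2[of ?g c "1 / lam" e] e by auto
  with gc have "k < c" by (cases "k = c") auto
  have "k_l lam n = k"
    unfolding k_l_def
  proof (rule the_equality)
    show "k \<in> {0<..<1} \<and> lam * integral {k..1} (\<lambda>t. (t - k) ^ (n - 1) / t ^ n) = (1 - k) ^ (n - 1)"
      using eq_iff[of k] k e c by auto
  next
    fix l assume l: "l \<in> {0<..<1} \<and> lam * integral {l..1} (\<lambda>t. (t - l) ^ (n - 1) / t ^ n) = (1 - l) ^ (n - 1)"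
    then have "?g l = ?g k" using eq_iff[of l] k by simp
    then show "l = k"
      using spa_ratio_strict_decreasing[OF n, of k l] spa_ratio_strict_decreasing[OF n, of l k] l k e c
      by (cases l k rule: linorder_cases) auto
  qed
  with \<open>k < c\<close> show ?thesis by simp
qed

section \<open>Comparing the revenue ratio with the threshold equation\<close>

lemma revenue_ratio_bound:
  fixes c :: real and n :: nat
  defines "P \<equiv> 1 - (1 - c) ^ n"
  assumes n: "1 \<le> n" and c: "0 < c" "c < 1"
  shows "P / (P + n * c * spa_integral n c) * spa_integral n c < (1 - c) ^ (n - 1)"
proof -
  let ?J = "spa_integral n c"
  let ?r = "(1 - c) ^ (n - 1)"
  obtain m where m: "n = Suc m" using n by (cases n) auto
  have J: "0 \<le> ?J" using c by (intro spa_integral_nonneg) auto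
  have P: "0 < P" using c n by (simp add: P_def power_less_one_iff)
  have Pn: "P \<le> n * c"
    using Bernoulli_inequality[of "- c" n] c by (simp add: P_def)
  have r: "0 < ?r" using c by simp
  have qn: "(1 - c) ^ n = (1 - c) * ?r" by (simp add: m)
  \<comment> \<open>The claim with its positive denominator cleared. A nonpositive bracket is
    harmless; otherwise \<open>?J\<close> is replaced by its bound
    \<open>(1 - c) ^ n / (n * c)\<close>, and the rest reduces to
    \<open>(1 - c) * P < n * c\<close>, which follows from \<open>P \<le> n * c\<close>.\<close>
  have "?J * (P - n * c * ?r) < ?r * P"
  proof (cases "P - n * c * ?r \<le> 0")
    case True
    then have "?J * (P - n * c * ?r) \<le> 0" using J by (simp add: mult_nonneg_nonpos)
    also have "0 < ?r * P" using r P by simp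
    finally show ?thesis .
  next
    case False
    have nc: "0 < n * c" using n c by simp
    have "n * c * (?J * (P - n * c * ?r)) \<le> ((1 - c) * ?r) * (P - n * c * ?r)"
      using mult_right_mono[OF spa_integral_upper[OF n c], of "P - n * c * ?r"] False
      by (simp add: qn mult_ac)
    also have "\<dots> = ?r * ((1 - c) * P - n * c * ((1 - c) * ?r))" by (simp add: algebra_simps)
    also have "\<dots> < ?r * (n * c * P)"
    proof (intro mult_strict_left_mono r)
      have "(1 - c) * P < n * c"
        using P Pn c by (smt (verit) mult_less_cancel_right2)
      moreover have "(1 - c) * ?r = 1 - P" by (simp add: P_def qn)
      ultimately show "(1 - c) * P - n * c * ((1 - c) * ?r) < n * c * P"
        by (simp only: right_diff_distrib)
    qed
    finally have "n * c * (?J * (P - n * c * ?r)) < n * c * (?r * P)" by (simp add: mult_ac)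
    then show ?thesis using nc by (simp only: mult_less_cancel_left_pos)
  qed
  then show ?thesis
    using P J n c by (simp add: divide_less_eq add_pos_nonneg algebra_simps)
qed

(* Both sides change by the same amount on a short interval, up to its length times the
   oscillation of the monotone P; telescoping over a fine partition gives equality. *)
lemma envelope_has_integral:
  fixes P X :: "real \<Rightarrow> real"
  assumes "c \<le> d"
    and ic: "\<And>u w. u \<in> {c..d} \<Longrightarrow> w \<in> {c..d} \<Longrightarrow> X w - u * P w \<le> X u - u * P u"
  shows "(P has_integral (X c - c * P c) - (X d - d * P d)) {c..d}"
proof -
  \<comment> \<open>Adding the constraints for \<open>(u, w)\<close> and \<open>(w, u)\<close> gives
    \<open>(w - u) * (P w - P u) \<le> 0\<close>.\<close>
  have anti: "P w \<le> P u" if "u \<in> {c..d}" "w \<in> {c..d}" "u \<le> w" for u w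
  proof (rule ccontr)
    assume "\<not> P w \<le> P u"
    then have "u \<noteq> w" by auto
    with \<open>\<not> P w \<le> P u\<close> that have "0 < (w - u) * (P w - P u)" by simp
    with ic[of u w] ic[of w u] that show False by (simp add: algebra_simps)
  qed
  have "mono_on {c..d} (\<lambda>u. - P u)" by (auto simp: mono_on_def anti)
  from integrable_on_mono_on[OF this] have int: "P integrable_on {c..d}" 
    using integrable_neg_iff[of P "{c..d}"] by simp
  have step: "\<bar>integral {u..w} P - ((X u - u * P u) - (X w - w * P w))\<bar> \<le> (w - u) * (P u - P w)"
    if "c \<le> u" "u \<le> w" "w \<le> d" for u w
  proof -
    have i: "P integrable_on {u..w}" using int by (rule integrable_on_subinterval) (use that in auto)
    have "integral {u..w} P \<le> integral {u..w} (\<lambda>_. P u)"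
      using i that by (intro integral_le) (auto intro!: anti)
    moreover have "integral {u..w} (\<lambda>_. P w) \<le> integral {u..w} P"
      using i that by (intro integral_le) (auto intro!: anti)
    ultimately show ?thesis
      using that ic[of u w] ic[of w u] by (simp add: algebra_simps abs_le_iff)
  qed
  let ?D = "\<bar>integral {c..d} P - ((X c - c * P c) - (X d - d * P d))\<bar>"
  have bound: "?D \<le> (d - c) * (P c - P d) / N" if "N > 0" for N :: nat
  proof -
    define z where "z i = c + (d - c) * (real i / N)" for i
    \<comment> \<open>The change of \<open>H\<close> over \<open>[c, d]\<close> is the quantity
      inside \<open>?D\<close>, so bounding its increments on the \<open>N\<close> cells bounds
      \<open>?D\<close>.\<close>
    define H where "H u = integral {c..u} P + (X u - u * P u)" for u
    have z: "c \<le> z i" "z i \<le> z (Suc i)" for i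
      using that \<open>c \<le> d\<close> by (auto simp: z_def intro!: mult_left_mono divide_right_mono)
    have zd: "z i \<le> d" if "i \<le> N" for i
    proof -
      have "(d - c) * (real i / N) \<le> d - c" using that \<open>N > 0\<close> \<open>c \<le> d\<close> by (intro mult_left_le) auto
      then show ?thesis by (simp add: z_def)
    qed
    have z0: "z 0 = c" "z N = d" using that by (auto simp: z_def)
    have dz: "z (Suc i) - z i = (d - c) / N" for i
      using that by (simp add: z_def field_simps)
    have Hstep: "\<bar>H (z (Suc i)) - H (z i)\<bar> \<le> (d - c) / N * (P (z i) - P (z (Suc i)))" if "i < N" for i
    proof -
      have "integral {c..z i} P + integral {z i..z (Suc i)} P = integral {c..z (Suc i)} P"
        using z[of i] zd[of "Suc i"] that int
        by (intro Henstock_Kurzweil_Integration.integral_combine)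
           (auto intro: integrable_on_subinterval)
      then show ?thesis
        using step[of "z i" "z (Suc i)"] z[of i] zd[of "Suc i"] that unfolding H_def dz by auto
    qed
    have "?D = \<bar>H (z N) - H (z 0)\<bar>" by (simp add: H_def z0)
    also have "\<dots> = \<bar>\<Sum>i<N. H (z (Suc i)) - H (z i)\<bar>" by (simp only: sum_lessThan_telescope[of "\<lambda>i. H (z i)"])
    also have "\<dots> \<le> (\<Sum>i<N. (d - c) / N * (P (z i) - P (z (Suc i))))"
      using Hstep by (intro order_trans[OF sum_abs] sum_mono) auto
    also have "\<dots> = (d - c) / N * (P c - P d)"
      by (simp only: sum_distrib_left[symmetric] sum_lessThan_telescope'[of "\<lambda>i. P (z i)"] z0)
    finally show ?thesis by simp
  qed
  have "?D \<le> 0"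
  proof (rule LIMSEQ_le_const)
    show "(\<lambda>N. (d - c) * (P c - P d) / real N) \<longlonglongrightarrow> 0"
      by (rule lim_const_over_n)
    show "\<exists>M. \<forall>N\<ge>M. ?D \<le> (d - c) * (P c - P d) / real N"
      using bound by (intro exI[of _ 1]) auto
  qed
  then have "integral {c..d} P = (X c - c * P c) - (X d - d * P d)" by simp
  then show ?thesis using integrable_integral[OF int] by simp
qed

subsection \<open>The equal-revenue distribution\<close>

text \<open>The quantile form: for \<open>u\<close> uniform on \<open>[0, 1]\<close> the value is
  \<open>a / u\<close> truncated at \<open>b\<close>. Clamping \<open>u\<close> keeps the value in
  \<open>[a, b]\<close> for every real \<open>u\<close>.\<close>

definition equal_revenue_map :: "real \<Rightarrow> real \<Rightarrow> real \<Rightarrow> real" where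
  "equal_revenue_map a b u = a / max (a / b) (min 1 u)"

text \<open>As an image of Lebesgue measure, it turns expectations into integrals over
  \<open>u\<close>, the variable of \<open>spa_integral\<close> and of the envelope formula.\<close>

definition equal_revenue :: "real \<Rightarrow> real \<Rightarrow> real measure" where
  "equal_revenue a b =
     distr (restrict_space lborel {0..1}) (restrict_space borel {a..b}) (equal_revenue_map a b)"

lemma equal_revenue_map_mem:
  assumes "0 < a" "a < b"
  shows "equal_revenue_map a b u \<in> {a..b}"
proof -
  define m where "m = max (a / b) (min 1 u)"
  have "0 < a / b" using assms by simp
  moreover have m: "a / b \<le> m" "m \<le> 1" using assms by (auto simp: m_def)
  ultimately have "0 < m" by linarith
  moreover have "a \<le> m * b" "m * a \<le> a"
    using assms m \<open>0 < m\<close> by (auto simp: pos_divide_le_eq mult_left_le_one_le)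
  ultimately have "a \<le> a / m" "a / m \<le> b" by (simp_all add: field_simps)
  then show ?thesis by (simp add: equal_revenue_map_def m_def[symmetric])
qed

lemma equal_revenue_map_eq:
  assumes "0 < a" "a < b"
  shows "u \<le> a / b \<Longrightarrow> equal_revenue_map a b u = b"
    and "a / b \<le> u \<Longrightarrow> u \<le> 1 \<Longrightarrow> equal_revenue_map a b u = a / u"
proof -
  have "a / b < 1" "a / (a / b) = b" using assms by auto
  moreover from this have "u \<le> a / b \<Longrightarrow> max (a / b) (min 1 u) = a / b"
    and "a / b \<le> u \<Longrightarrow> u \<le> 1 \<Longrightarrow> max (a / b) (min 1 u) = u"
    by linarith+
  ultimately show "u \<le> a / b \<Longrightarrow> equal_revenue_map a b u = b"
    and "a / b \<le> u \<Longrightarrow> u \<le> 1 \<Longrightarrow> equal_revenue_map a b u = a / u"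
    by (simp_all only: equal_revenue_map_def)
qed

lemma measurable_equal_revenue_map:
  assumes "0 < a" "a < b"
  shows "equal_revenue_map a b \<in> measurable (restrict_space lborel {0..1}) (restrict_space borel {a..b})"
proof (rule measurable_restrict_space2)
  show "equal_revenue_map a b \<in> space (restrict_space lborel {0..1}) \<rightarrow> {a..b}"
    using equal_revenue_map_mem[OF assms] by auto
  show "equal_revenue_map a b \<in> borel_measurable (restrict_space lborel {0..1})"
    unfolding equal_revenue_map_def[abs_def] by (intro measurable_restrict_space1) measurable
qed

lemma sets_equal_revenue[simp, measurable_cong]:
  "sets (equal_revenue a b) = sets (restrict_space borel {a..b})"
  by (simp add: equal_revenue_def)

lemma prob_space_equal_revenue:
  assumes "0 < a" "a < b"
  shows "prob_space (equal_revenue a b)"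
  unfolding equal_revenue_def
  using measurable_equal_revenue_map[OF assms]
  by (intro prob_space.prob_space_distr prob_space_restrict_space) auto

lemma emeasure_equal_revenue_less:
  assumes ab: "0 < a" "a < b" and t: "a \<le> t" "t \<le> b"
  shows "emeasure (equal_revenue a b) {v\<in>{a..b}. v < t} = ennreal (1 - a / t)"
proof -
  have t0: "0 < t" using ab t by simp
  have at: "a / b \<le> a / t" "a / t \<le> 1" "0 < a / t" using ab t t0 by (auto intro!: divide_left_mono)
  \<comment> \<open>Points \<open>u \<le> a / b\<close> are sent to the atom \<open>b\<close>, which
    is not below \<open>t\<close> even when \<open>t = b\<close>; for the others
    \<open>a / u < t\<close> means \<open>a / t < u\<close>.\<close>
  have iff: "equal_revenue_map a b u < t \<longleftrightarrow> a / t < u" if "u \<in> {0..1}" for u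
  proof (cases "u \<le> a / b")
    case True then show ?thesis using equal_revenue_map_eq(1)[OF ab True] t at by auto
  next
    case False
    moreover from this have "0 < u" using ab by (smt (verit) divide_pos_pos)
    moreover have "equal_revenue_map a b u = a / u"
      using equal_revenue_map_eq(2)[OF ab, of u] False that by simp
    ultimately show ?thesis using t0 by (simp add: divide_less_eq mult.commute)
  qed
  have "{v\<in>{a..b}. v < t} = {a..b} \<inter> {..<t}" by auto
  then have "{v\<in>{a..b}. v < t} \<in> sets (restrict_space borel {a..b})"
    by (auto simp: sets_restrict_space)
  then have "emeasure (equal_revenue a b) {v\<in>{a..b}. v < t} =
    emeasure (restrict_space lborel {0..1})
      (equal_revenue_map a b -` {v\<in>{a..b}. v < t} \<inter> space (restrict_space lborel {0..1}))"
    unfolding equal_revenue_def by (rule emeasure_distr[OF measurable_equal_revenue_map[OF ab]])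
  also have "equal_revenue_map a b -` {v\<in>{a..b}. v < t} \<inter> space (restrict_space lborel {0..1}) =
      {a / t<..1}"
    using equal_revenue_map_mem[OF ab] iff at by auto
  also have "emeasure (restrict_space lborel {0..1}) {a / t<..1} = emeasure lborel {a / t<..1}"
    using at by (intro emeasure_restrict_space) auto
  also have "\<dots> = ennreal (1 - a / t)" using at by simp
  finally show ?thesis .
qed

text \<open>The weight \<open>(1 - a / v) ^ (n - 1)\<close> is the probability that the other
  \<open>n - 1\<close> values lie strictly below \<open>v\<close>. Under \<open>v = a / u\<close>
  the integrand becomes \<open>a * (1 - u) ^ (n - 1) / u\<close>; the indicator removes the
  atom.\<close>

lemma nn_integral_equal_revenue_lower:
  assumes ab: "0 < a" "a < b"
  shows "ennreal (a * spa_integral n (a / b)) \<le>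
    (\<integral>\<^sup>+v. ennreal (v * (1 - a / v) ^ (n - 1)) * indicator {..<b} v \<partial>equal_revenue a b)"
proof -
  let ?c = "a / b" and ?m = "n - 1"
  let ?f = "\<lambda>v. ennreal (v * (1 - a / v) ^ ?m) * indicator {..<b} v"
  have c: "0 < ?c" "?c < 1" using ab by auto
  have "((\<lambda>u. (1 - u) ^ ?m / u) has_integral spa_integral n ?c) {?c..1}"
    unfolding spa_integral_def using c
    by (intro integrable_integral integrable_continuous_real continuous_on_spa_integrand)
  then have "((\<lambda>u. a * ((1 - u) ^ ?m / u)) has_integral a * spa_integral n ?c) {?c..1}"
    by (rule has_integral_mult_right)
  then have "ennreal (a * spa_integral n ?c) =
      (\<integral>\<^sup>+u. ennreal (a * ((1 - u) ^ ?m / u)) * indicator {?c..1} u \<partial>lborel)"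
    using ab c by (intro nn_integral_has_integral_lebesgue'[symmetric])
      (auto intro!: mult_nonneg_nonneg divide_nonneg_nonneg dest: order_trans[OF less_imp_le[OF c(1)]])
  also have "\<dots> \<le> (\<integral>\<^sup>+u. ?f (equal_revenue_map a b u) * indicator {0..1} u \<partial>lborel)"
  proof (rule nn_integral_mono_AE)
    \<comment> \<open>The point \<open>u = a / b\<close> is excluded because it maps to the atom
      \<open>b\<close>, where the right-hand side vanishes; a single point is null.\<close>
    have "ennreal (a * ((1 - u) ^ ?m / u)) * indicator {?c..1} u \<le>
        ?f (equal_revenue_map a b u) * indicator {0..1} u" if "u \<noteq> ?c" for u
    proof (cases "u \<in> {?c..1}")
      case True
      with that c have u: "?c < u" "u \<le> 1" "0 < u" by auto
      then have "equal_revenue_map a b u = a / u" "a / u < b"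
        using equal_revenue_map_eq(2)[OF ab, of u] ab by (auto simp: field_simps)
      then show ?thesis using u ab by simp
    qed simp
    then show "AE u in lborel. ennreal (a * ((1 - u) ^ ?m / u)) * indicator {?c..1} u \<le>
        ?f (equal_revenue_map a b u) * indicator {0..1} u"
      using AE_lborel_singleton[of ?c] by auto
  qed
  also have "\<dots> = (\<integral>\<^sup>+u. ?f (equal_revenue_map a b u) \<partial>restrict_space lborel {0..1})"
    by (subst nn_integral_restrict_space) auto
  also have "\<dots> = (\<integral>\<^sup>+v. ?f v \<partial>equal_revenue a b)"
    unfolding equal_revenue_def
    by (rule nn_integral_distr[OF measurable_equal_revenue_map[OF ab], symmetric])
       (auto intro!: measurable_restrict_space1)
  finally show ?thesis .
qed

section \<open>Payments of a single buyer\<close>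

text \<open>When \<open>f\<close> is not Lebesgue integrable its Lebesgue integral is
  \<open>0\<close> by convention, so the sign of the gauge integral carries over in either case.
  Payments can thus be treated slice by slice without an integrability check.\<close>

lemma lebesgue_integral_nonneg_of_has_integral:
  fixes f :: "real \<Rightarrow> real"
  assumes "(f has_integral I) S" "0 \<le> I"
  shows "0 \<le> (LINT u:S|lborel. f u)"
proof (cases "set_integrable lborel S f")
  case True
  from set_borel_integral_eq_integral(2)[OF this] integral_unique[OF assms(1)] assms(2)
  show ?thesis by simp
next
  case False
  then show ?thesis
    by (simp add: set_lebesgue_integral_def set_integrable_def not_integrable_integral_eq)
qed

(* By the envelope formula the left-hand side minus the expected payment is the utility of the
   lowest type: every price in [a, b] earns a on the equal-revenue distribution. *)
lemma single_buyer_payment_bound: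
  fixes x p :: "real \<Rightarrow> real"
  assumes ab: "0 < a" "a < b"
    and meas: "x \<in> borel_measurable (restrict_space borel {a..b})"
      "p \<in> borel_measurable (restrict_space borel {a..b})"
    and ir: "p a \<le> a * x a"
    and ic: "\<And>v w. v \<in> {a..b} \<Longrightarrow> w \<in> {a..b} \<Longrightarrow> v * x w - p w \<le> v * x v - p v"
  shows "0 \<le> (\<integral>v. b * x v * indicator {b} v - p v \<partial>equal_revenue a b)"
proof -
  let ?c = "a / b"
  let ?h = "\<lambda>v. b * x v * indicator {b} v - p v"
  let ?g = "\<lambda>u. ?h (equal_revenue_map a b u)"
  have c: "0 < ?c" "?c < 1" using ab by auto
  \<comment> \<open>The point \<open>u\<close> stands for the type \<open>a / u\<close>. Its
    incentive constraint multiplied by \<open>u\<close> has the form that the envelope lemma asks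
    for, with \<open>X u = a * x (a / u)\<close> and \<open>P u = p (a / u)\<close>.\<close>
  have "((\<lambda>u. p (a / u)) has_integral
      (a * x (a / ?c) - ?c * p (a / ?c)) - (a * x (a / 1) - 1 * p (a / 1))) {?c..1}"
  proof (rule envelope_has_integral)
    fix u w assume uw: "u \<in> {?c..1}" "w \<in> {?c..1}"
    have "a / t \<in> {a..b}" if "t \<in> {?c..1}" for t
      using equal_revenue_map_mem[OF ab, of t] equal_revenue_map_eq(2)[OF ab, of t] that by simp
    with uw have "a / u * x (a / w) - p (a / w) \<le> a / u * x (a / u) - p (a / u)" by (intro ic)
    then have "u * (a / u * x (a / w) - p (a / w)) \<le> u * (a / u * x (a / u) - p (a / u))"
      using uw c by (intro mult_left_mono) auto
    moreover have "u \<noteq> 0" using uw c by auto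
    ultimately show "a * x (a / w) - u * p (a / w) \<le> a * x (a / u) - u * p (a / u)"
      by (simp add: right_diff_distrib)
  qed (use c in simp)
  from has_integral_neg[OF this]
  have "((\<lambda>u. - p (a / u)) has_integral ?c * p b - a * x b + (a * x a - p a)) {?c..1}"
    using ab by (simp add: algebra_simps)
  \<comment> \<open>At the single point \<open>u = a / b\<close> the value is \<open>b\<close> and
    the indicator contributes, hence the spike set.\<close>
  then have 1: "(?g has_integral ?c * p b - a * x b + (a * x a - p a)) {?c..1}"
  proof (rule has_integral_spike[of "{?c}", rotated 2])
    fix u assume u: "u \<in> {?c..1} - {?c}"
    then have "?c < u" by auto
    moreover from this have "0 < u" using c by linarith
    ultimately have "a / u < b" "0 < u" using ab by (auto simp: field_simps)
    then show "?g u = - p (a / u)" using equal_revenue_map_eq(2)[OF ab, of u] u by simp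
  qed simp
  \<comment> \<open>On \<open>[0, a / b]\<close> every \<open>u\<close> is sent to \<open>b\<close>,
    so the integrand is constant there.\<close>
  have "((\<lambda>u. b * x b - p b) has_integral ?c * (b * x b - p b)) {0..?c}"
    using has_integral_const_real[of "b * x b - p b" 0 ?c] c by simp
  then have 2: "(?g has_integral ?c * (b * x b - p b)) {0..?c}"
    by (rule has_integral_eq[rotated]) (simp add: equal_revenue_map_eq(1)[OF ab])
  have "(?g has_integral ?c * (b * x b - p b) + (?c * p b - a * x b + (a * x a - p a))) {0..1}"
    using c by (intro has_integral_combine[OF _ _ 2 1]) auto
  moreover have "?c * (b * x b - p b) + (?c * p b - a * x b + (a * x a - p a)) = a * x a - p a"
    using ab by (simp add: right_diff_distrib)
  ultimately have "0 \<le> (LINT u:{0..1}|lborel. ?g u)"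
    using ir by (intro lebesgue_integral_nonneg_of_has_integral) auto
  also have "\<dots> = (\<integral>u. ?g u \<partial>restrict_space lborel {0..1})"
    by (simp add: set_lebesgue_integral_def integral_restrict_space)
  also have "\<dots> = (\<integral>v. ?h v \<partial>equal_revenue a b)"
    unfolding equal_revenue_def
  proof (rule integral_distr[OF measurable_equal_revenue_map[OF ab], symmetric])
    show "?h \<in> borel_measurable (restrict_space borel {a..b})"
      by (intro borel_measurable_diff borel_measurable_times borel_measurable_const meas
          measurable_restrict_space1 borel_measurable_indicator) simp
  qed
  finally show ?thesis .
qed

subsection \<open>Independent values\<close>

lemma profiles_component: "v \<in> profiles n a b \<Longrightarrow> i < n \<Longrightarrow> v i \<in> {a..b}"
  unfolding profiles_def by (drule PiE_mem[where x = i]) simp_all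

lemma M_allD:
  assumes "(x, p) \<in> M_all n a b"
  shows "i < n \<Longrightarrow> (\<lambda>v. x v i) \<in> borel_measurable (profile_space n a b)"
    and "i < n \<Longrightarrow> (\<lambda>v. p v i) \<in> borel_measurable (profile_space n a b)"
    and "v \<in> profiles n a b \<Longrightarrow> i < n \<Longrightarrow> x v i \<in> {0..1}"
    and "v \<in> profiles n a b \<Longrightarrow> i < n \<Longrightarrow> p v i \<le> v i * x v i"
    and "v \<in> profiles n a b \<Longrightarrow> i < n \<Longrightarrow> w \<in> {a..b} \<Longrightarrow>
      v i * x (v(i := w)) i - p (v(i := w)) i \<le> v i * x v i - p v i"
    and "v \<in> profiles n a b \<Longrightarrow> (\<Sum>i<n. x v i) \<le> 1"
  using assms
  unfolding M_all_def is_mechanism_def individually_rational_def incentive_compatible_def feasible_def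
  by simp_all

lemma ext_expectation_eq_integral:
  assumes "integrable M f"
  shows "ext_expectation M f = ereal (integral\<^sup>L M f)"
proof -
  have "(\<integral>\<^sup>+ v. ennreal (f v) \<partial>M) \<noteq> \<top>" "(\<integral>\<^sup>+ v. ennreal (- f v) \<partial>M) \<noteq> \<top>"
    using assms by (auto simp: real_integrable_def)
  moreover have "enn2ereal e = ereal (enn2real e)" if "e \<noteq> \<top>" for e
    using that by (cases e) auto
  ultimately show ?thesis
    by (simp add: ext_expectation_def real_lebesgue_integral_def[OF assms])
qed

text \<open>Stated for arbitrary \<open>F\<close>: the lower bound on the maximin ratio ranges over
  every i.i.d. distribution, while the upper bound uses the equal-revenue instance.\<close>

locale iid_profile =
  fixes n :: nat and a b :: real and F :: "real measure"
  assumes prob_space_F: "prob_space F"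
    and sets_F[measurable_cong]: "sets F = sets (restrict_space borel {a..b})"
begin

sublocale product_prob_space "\<lambda>_::nat. F" "{..<n}"
  by (intro product_prob_spaceI prob_space_F)

abbreviation Prof :: "(nat \<Rightarrow> real) measure" where
  "Prof \<equiv> Pi\<^sub>M {..<n} (\<lambda>_. F)"

lemma space_F: "space F = {a..b}"
  using sets_eq_imp_space_eq[OF sets_F] by (simp add: space_restrict_space)

lemma space_Prof: "space Prof = profiles n a b"
  by (simp add: space_PiM space_F profiles_def)

lemma sets_Prof: "sets Prof = sets (profile_space n a b)"
  unfolding profile_space_def by (intro sets_PiM_cong) (auto simp: sets_F)

lemma less_event_F: "{v\<in>{a..b}. v < t} \<in> sets F"
proof -
  have "{v\<in>{a..b}. v < t} = {a..b} \<inter> {..<t}" by auto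
  then show ?thesis unfolding sets_F sets_restrict_space by (simp add: imageI)
qed

lemma borel_measurable_F: "f \<in> borel_measurable borel \<Longrightarrow> f \<in> borel_measurable F"
  using measurable_restrict_space1[of f borel borel "{a..b}"] sets_F
  by (metis measurable_cong_sets)

lemma borel_measurable_component[measurable]:
  "i < n \<Longrightarrow> (\<lambda>v. v i) \<in> borel_measurable Prof"
  using measurable_compose[OF measurable_component_singleton[of i "{..<n}" "\<lambda>_. F"]
      borel_measurable_F[of "\<lambda>x. x"]] by simp

lemma measurable_insert_component:
  "i < n \<Longrightarrow> r \<in> space (Pi\<^sub>M ({..<n} - {i}) (\<lambda>_. F)) \<Longrightarrow> (\<lambda>s. r(i := s)) \<in> measurable F Prof"
  by (rule measurable_fun_upd[where J = "{..<n} - {i}"]) auto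

lemma insert_component_mem:
  "i < n \<Longrightarrow> r \<in> space (Pi\<^sub>M ({..<n} - {i}) (\<lambda>_. F)) \<Longrightarrow> s \<in> {a..b} \<Longrightarrow> r(i := s) \<in> profiles n a b"
  by (auto simp: space_PiM profiles_def space_F PiE_iff extensional_def)

lemma Max_mem:
  assumes "v \<in> profiles n a b" "1 \<le> n"
  shows "Max (v ` {..<n}) \<in> {a..b}"
proof -
  have "Max (v ` {..<n}) \<in> v ` {..<n}" using assms(2) by (intro Max_in) (auto simp: lessThan_empty_iff)
  then show ?thesis using assms(1) by (auto simp: profiles_def PiE_iff)
qed

lemma borel_measurable_Max: "1 \<le> n \<Longrightarrow> (\<lambda>v. Max (v ` {..<n})) \<in> borel_measurable Prof"
  by (rule borel_measurable_Max) auto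

lemma
  assumes "1 \<le> n"
  shows integrable_Max: "integrable Prof (\<lambda>v. Max (v ` {..<n}))"
    and expectation_Max_mem: "(\<integral>v. Max (v ` {..<n}) \<partial>Prof) \<in> {a..b}"
proof -
  have bd: "a \<le> Max (v ` {..<n})" "Max (v ` {..<n}) \<le> b" if "v \<in> space Prof" for v
    using Max_mem[of v] that assms by (auto simp: space_Prof)
  show i: "integrable Prof (\<lambda>v. Max (v ` {..<n}))"
  proof (intro P.integrable_const_bound[where B = "\<bar>a\<bar> + \<bar>b\<bar>"] AE_I2 borel_measurable_Max assms)
    fix v assume "v \<in> space Prof"
    from bd[OF this] show "norm (Max (v ` {..<n})) \<le> \<bar>a\<bar> + \<bar>b\<bar>" by simp
  qed
  show "(\<integral>v. Max (v ` {..<n}) \<partial>Prof) \<in> {a..b}"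
    using P.integral_ge_const[OF i AE_I2[OF bd(1)]] P.integral_le_const[OF i AE_I2[OF bd(2)]] by simp
qed

end

section \<open>Revenue and expected maximum for i.i.d. equal-revenue values\<close>

locale equal_revenue_profile =
  fixes n :: nat and a b :: real
  assumes n: "1 \<le> n" and ab: "0 < a" "a < b"
begin

sublocale iid_profile n a b "equal_revenue a b"
  by (intro iid_profile.intro prob_space_equal_revenue ab sets_equal_revenue)

definition some_top :: "(nat \<Rightarrow> real) set" where
  "some_top = {v \<in> space Prof. \<exists>i<n. v i = b}"

lemma some_top_event[measurable]: "some_top \<in> sets Prof"
  unfolding some_top_def by measurable

text \<open>The complement is a box whose sides are the values below \<open>b\<close>, each of mass
  \<open>1 - a / b\<close>.\<close>

lemma prob_some_top: "P.prob some_top = 1 - (1 - a / b) ^ n"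
proof -
  let ?A = "{v\<in>{a..b}. v < b}"
  note A = less_event_F[of b]
  have c: "0 \<le> 1 - a / b" using ab by simp
  have eq: "space Prof - some_top = Pi\<^sub>E {..<n} (\<lambda>_. ?A)"
  proof (intro set_eqI iffI)
    fix v assume v: "v \<in> space Prof - some_top"
    then have vp: "v \<in> ({..<n} \<rightarrow>\<^sub>E {a..b})" by (simp add: space_Prof profiles_def)
    show "v \<in> Pi\<^sub>E {..<n} (\<lambda>_. ?A)"
    proof (rule PiE_I)
      fix i assume i: "i \<in> {..<n}"
      have "v i \<in> {a..b}" using vp i by (rule PiE_mem)
      moreover have "v i \<noteq> b" using v i by (simp add: some_top_def)
      ultimately show "v i \<in> ?A" by simp
    next
      fix i assume "i \<notin> {..<n}" with vp show "v i = undefined" by (rule PiE_arb)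
    qed
  next
    fix v assume v: "v \<in> Pi\<^sub>E {..<n} (\<lambda>_. ?A)"
    have "?A \<subseteq> {a..b}" by blast
    with v have "v \<in> space Prof" unfolding space_Prof profiles_def by (meson PiE_mono subsetD)
    moreover have "v \<notin> some_top"
      using PiE_mem[OF v] unfolding some_top_def by fastforce
    ultimately show "v \<in> space Prof - some_top" by simp
  qed
  have "emeasure Prof (space Prof - some_top) = (\<Prod>i<n. emeasure (equal_revenue a b) ?A)"
    unfolding eq by (rule emeasure_PiM[OF finite_lessThan A])
  also have "\<dots> = ennreal ((1 - a / b) ^ n)"
    using emeasure_equal_revenue_less[OF ab, of b] ab c by (simp add: ennreal_power)
  finally have "emeasure Prof (space Prof - some_top) = ennreal ((1 - a / b) ^ n)" .
  then have "P.prob (space Prof - some_top) = (1 - a / b) ^ n"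
    using c by (simp only: measure_def enn2real_ennreal zero_le_power)
  then show ?thesis
    using P.prob_compl[OF some_top_event] by linarith
qed

lemma insert_lessThan: "i < n \<Longrightarrow> insert i ({..<n} - {i}) = {..<n}"
  by auto

text \<open>The value of buyer \<open>i\<close> is integrated first, with the other values
  \<open>r\<close> held fixed. Each slice is an incentive-compatible, individually rational rule for
  one buyer, so the single-buyer bound applies; integrability of the payment justifies the iterated
  integral.\<close>

lemma buyer_payment_bound:
  assumes m: "(x, p) \<in> M_all n a b" and i: "i < n" and int: "integrable Prof (\<lambda>v. p v i)"
  shows "integrable Prof (\<lambda>v. b * x v i * indicator {b} (v i))"
    and "(\<integral>v. p v i \<partial>Prof) \<le> (\<integral>v. b * x v i * indicator {b} (v i) \<partial>Prof)"
proof -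
  note D = M_allD[OF m]
  have xm[measurable]: "(\<lambda>v. x v i) \<in> borel_measurable Prof"
    and pm: "(\<lambda>v. p v i) \<in> borel_measurable Prof"
    using D(1,2)[OF i] measurable_cong_sets[OF sets_Prof refl, of borel] by auto
  have vm[measurable]: "(\<lambda>v. v i) \<in> borel_measurable Prof" by (rule borel_measurable_component[OF i])
  show int': "integrable Prof (\<lambda>v. b * x v i * indicator {b} (v i))"
    using D(3)[OF _ i] ab
    by (intro P.integrable_const_bound[where B = b] AE_I2)
       (auto simp: space_Prof abs_mult indicator_def)
  have "0 \<le> (\<integral>v. b * x v i * indicator {b} (v i) - p v i \<partial>Prof)"
  proof -
    let ?f = "\<lambda>v. b * x v i * indicator {b} (v i) - p v i"
    have "integral\<^sup>L Prof ?f =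
      (\<integral>r. (\<integral>s. ?f (r(i := s)) \<partial>equal_revenue a b) \<partial>Pi\<^sub>M ({..<n} - {i}) (\<lambda>_. equal_revenue a b))"
      using product_integral_insert[of "{..<n} - {i}" i ?f] insert_lessThan[OF i] int int' by simp
    also have "\<dots> \<ge> 0"
    proof (rule Bochner_Integration.integral_nonneg)
      fix r assume r: "r \<in> space (Pi\<^sub>M ({..<n} - {i}) (\<lambda>_. equal_revenue a b))"
      note mem = insert_component_mem[OF i r]
      have meas: "(\<lambda>s. f (r(i := s))) \<in> borel_measurable (restrict_space borel {a..b})"
        if "f \<in> borel_measurable Prof" for f :: "(nat \<Rightarrow> real) \<Rightarrow> real"
        using measurable_compose[OF measurable_insert_component[OF i r] that]
          measurable_cong_sets[OF sets_F refl, of borel] by simp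
      have "0 \<le> (\<integral>s. b * x (r(i := s)) i * indicator {b} s - p (r(i := s)) i \<partial>equal_revenue a b)"
      proof (rule single_buyer_payment_bound[OF ab meas[OF xm] meas[OF pm]])
        show "p (r(i := a)) i \<le> a * x (r(i := a)) i"
          using D(4)[OF mem i, of a] ab by simp
        show "v * x (r(i := w)) i - p (r(i := w)) i \<le> v * x (r(i := v)) i - p (r(i := v)) i"
          if "v \<in> {a..b}" "w \<in> {a..b}" for v w
          using D(5)[OF mem[OF that(1)] i that(2)] by simp
      qed
      then show "0 \<le> (\<integral>s. ?f (r(i := s)) \<partial>equal_revenue a b)" by simp
    qed
    finally show ?thesis .
  qed
  then show "(\<integral>v. p v i \<partial>Prof) \<le> (\<integral>v. b * x v i * indicator {b} (v i) \<partial>Prof)"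
    using int int' by simp
qed

text \<open>Summing the buyers' bounds leaves \<open>b\<close> times the expected allocation to
  buyers of value \<open>b\<close>; feasibility caps this allocation by \<open>1\<close>, and it
  vanishes off \<open>some_top\<close>. If the negative part of the revenue has infinite integral,
  the expectation is minus infinity and the bound is trivial.\<close>

lemma revenue_upper:
  assumes m: "m \<in> M_all n a b"
  shows "ext_expectation Prof (\<lambda>v. \<Sum>i<n. snd m v i) \<le> ereal (b * (1 - (1 - a / b) ^ n))"
proof -
  obtain x p where xp: "m = (x, p)" by (cases m)
  note D = M_allD[OF m[unfolded xp]]
  let ?s = "\<lambda>v. \<Sum>i<n. p v i"
  have pm: "(\<lambda>v. p v i) \<in> borel_measurable Prof" if "i < n" for i
    using D(2)[OF that] measurable_cong_sets[OF sets_Prof refl, of borel] by auto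
  then have sm: "?s \<in> borel_measurable Prof" by (intro borel_measurable_sum) auto
  have p_le: "p v i \<le> b" if "v \<in> space Prof" "i < n" for v i
  proof -
    have v: "v \<in> profiles n a b" using that by (simp add: space_Prof)
    then have "v i \<in> {a..b}" using that(2) by (rule profiles_component)
    then have "v i * x v i \<le> b * 1" using D(3)[OF v that(2)] ab by (intro mult_mono) auto
    then show ?thesis using D(4)[OF v that(2)] by simp
  qed
  have pos: "(\<integral>\<^sup>+v. ennreal (?s v) \<partial>Prof) \<noteq> \<infinity>"
  proof -
    have "(\<integral>\<^sup>+v. ennreal (?s v) \<partial>Prof) \<le> (\<integral>\<^sup>+v. ennreal (n * b) \<partial>Prof)"
    proof (intro nn_integral_mono ennreal_leI)
      fix v assume v: "v \<in> space Prof"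
      show "?s v \<le> n * b"
        using sum_bounded_above[of "{..<n}" "\<lambda>i. p v i" b] p_le[OF v] by simp
    qed
    also have "\<dots> < \<infinity>" by (simp add: P.emeasure_space_1 ennreal_mult_less_top)
    finally show ?thesis by simp
  qed
  show ?thesis
  proof (cases "(\<integral>\<^sup>+v. ennreal (- ?s v) \<partial>Prof) = \<infinity>")
    case True
    have "ext_expectation Prof ?s = - \<infinity>"
      unfolding ext_expectation_def True using pos
      by (cases "\<integral>\<^sup>+v. ennreal (?s v) \<partial>Prof") auto
    then show ?thesis by (simp add: xp)
  next
    case False
    then have si: "integrable Prof ?s" using sm pos by (simp add: real_integrable_def)
    \<comment> \<open>Integrability of the sum passes to each payment: it is the total minus the
      other payments, all at most \<open>b\<close>, so it is bounded below by
      \<open>- \<bar>?s v\<bar> - n * b\<close>.\<close>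
    have pi: "integrable Prof (\<lambda>v. p v i)" if i: "i < n" for i
    proof (rule Bochner_Integration.integrable_bound)
      show "integrable Prof (\<lambda>v. \<bar>?s v\<bar> + n * b)" using si by (intro Bochner_Integration.integrable_add) auto
      show "AE v in Prof. norm (p v i) \<le> norm (\<bar>?s v\<bar> + n * b)"
      proof (rule AE_I2)
        fix v assume v: "v \<in> space Prof"
        have "?s v = p v i + (\<Sum>j\<in>{..<n} - {i}. p v j)" using i by (intro sum.remove) auto
        moreover have "(\<Sum>j\<in>{..<n} - {i}. p v j) \<le> real (card ({..<n} - {i})) * b"
          using p_le[OF v] by (intro sum_bounded_above) auto
        moreover have "real (card ({..<n} - {i})) * b \<le> n * b"
          using ab i by (intro mult_right_mono) auto
        moreover have "b \<le> n * b" using n ab by simp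
        ultimately show "norm (p v i) \<le> norm (\<bar>?s v\<bar> + n * b)"
          using p_le[OF v i] ab(1) ab(2) unfolding real_norm_def by linarith
      qed
    qed (rule pm[OF i])
    have "integral\<^sup>L Prof ?s = (\<Sum>i<n. \<integral>v. p v i \<partial>Prof)"
      using pi by (intro Bochner_Integration.integral_sum) auto
    also have "\<dots> \<le> (\<Sum>i<n. \<integral>v. b * x v i * indicator {b} (v i) \<partial>Prof)"
      using buyer_payment_bound(2)[OF m[unfolded xp] _ pi] by (intro sum_mono) auto
    also have "\<dots> = (\<integral>v. (\<Sum>i<n. b * x v i * indicator {b} (v i)) \<partial>Prof)"
      using buyer_payment_bound(1)[OF m[unfolded xp] _ pi]
      by (intro Bochner_Integration.integral_sum[symmetric]) auto
    also have "\<dots> \<le> (\<integral>v. b * indicator some_top v \<partial>Prof)"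
    proof (rule integral_mono)
      show "integrable Prof (\<lambda>v. \<Sum>i<n. b * x v i * indicator {b} (v i))"
        using buyer_payment_bound(1)[OF m[unfolded xp] _ pi]
        by (intro Bochner_Integration.integrable_sum) auto
      show "integrable Prof (\<lambda>v. b * indicator some_top v)"
        by (intro integrable_mult_right integrable_real_indicator) (auto simp: P.emeasure_eq_measure)
      fix v assume v: "v \<in> space Prof"
      then have vp: "v \<in> profiles n a b" by (simp add: space_Prof)
      show "(\<Sum>i<n. b * x v i * indicator {b} (v i)) \<le> b * indicator some_top v"
      proof (cases "v \<in> some_top")
        case True
        have "(\<Sum>i<n. b * x v i * indicator {b} (v i)) \<le> (\<Sum>i<n. b * x v i)"
          using D(3)[OF vp] ab by (intro sum_mono) (auto simp: indicator_def)
        also have "\<dots> \<le> b * 1"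
          unfolding sum_distrib_left[symmetric] using D(6)[OF vp] ab by (intro mult_left_mono) auto
        finally show ?thesis using True by simp
      next
        case False
        with v have "v i \<noteq> b" if "i < n" for i using that unfolding some_top_def by blast
        then have "(\<Sum>i<n. b * x v i * indicator {b} (v i)) = 0" by (intro sum.neutral) simp
        then show ?thesis using False by simp
      qed
    qed
    also have "\<dots> = b * (1 - (1 - a / b) ^ n)"
      by (simp add: prob_some_top)
    finally show ?thesis
      using ext_expectation_eq_integral[OF si] by (simp add: xp)
  qed
qed

text \<open>Strictness makes the supports for different \<open>i\<close> disjoint, and it makes the
  event a box in the other coordinates once \<open>v i\<close> is fixed. Values equal to
  \<open>b\<close> are left to \<open>some_top\<close>.\<close>

definition unique_max :: "nat \<Rightarrow> (nat \<Rightarrow> real) \<Rightarrow> ennreal" where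
  "unique_max i v = ennreal (v i) * indicator {..<b} (v i) * indicator {v. \<forall>j\<in>{..<n} - {i}. v j < v i} v"

lemma measurable_unique_max[measurable]: "i < n \<Longrightarrow> unique_max i \<in> borel_measurable Prof"
  unfolding unique_max_def[abs_def] by measurable

text \<open>Given \<open>v i = s\<close>, the other values must fall in a box of mass
  \<open>(1 - a / s) ^ (n - 1)\<close>. The remaining integral over \<open>s\<close> is the one
  bounded in \<open>nn_integral_equal_revenue_lower\<close>.\<close>

lemma nn_integral_unique_max:
  assumes i: "i < n"
  shows "ennreal (a * spa_integral n (a / b)) \<le> (\<integral>\<^sup>+v. unique_max i v \<partial>Prof)"
proof -
  let ?J = "{..<n} - {i}"
  let ?R = "Pi\<^sub>M ?J (\<lambda>_. equal_revenue a b)"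
  have "ennreal (a * spa_integral n (a / b)) \<le>
      (\<integral>\<^sup>+s. ennreal (s * (1 - a / s) ^ (n - 1)) * indicator {..<b} s \<partial>equal_revenue a b)"
    by (rule nn_integral_equal_revenue_lower[OF ab])
  also have "\<dots> = (\<integral>\<^sup>+s. (\<integral>\<^sup>+r. unique_max i (r(i := s)) \<partial>?R) \<partial>equal_revenue a b)"
  proof (rule nn_integral_cong)
    fix s assume "s \<in> space (equal_revenue a b)"
    then have s: "a \<le> s" "s \<le> b" "0 < s" using ab by (auto simp: space_F)
    let ?A = "{v\<in>{a..b}. v < s}"
    note A = less_event_F[of s]
    have "(\<integral>\<^sup>+r. unique_max i (r(i := s)) \<partial>?R) =
        (\<integral>\<^sup>+r. ennreal s * indicator {..<b} s * indicator (Pi\<^sub>E ?J (\<lambda>_. ?A)) r \<partial>?R)"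
      by (intro nn_integral_cong)
         (auto simp: unique_max_def indicator_def space_PiM space_F PiE_iff extensional_def)
    also have "\<dots> = ennreal s * indicator {..<b} s * emeasure ?R (Pi\<^sub>E ?J (\<lambda>_. ?A))"
      using A by (intro nn_integral_cmult_indicator sets_PiM_I_finite) auto
    also have "emeasure ?R (Pi\<^sub>E ?J (\<lambda>_. ?A)) = ennreal ((1 - a / s) ^ (n - 1))"
      using emeasure_PiM[of ?J "\<lambda>_. ?A"] A emeasure_equal_revenue_less[OF ab s(1,2)] i s
      by (simp add: ennreal_power)
    also have "ennreal s * indicator {..<b} s * ennreal ((1 - a / s) ^ (n - 1)) =
        ennreal (s * (1 - a / s) ^ (n - 1)) * indicator {..<b} s"
      using s by (simp add: ennreal_mult mult_ac)
    finally show "ennreal (s * (1 - a / s) ^ (n - 1)) * indicator {..<b} s =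
        (\<integral>\<^sup>+r. unique_max i (r(i := s)) \<partial>?R)"
      by (rule sym)
  qed
  also have "\<dots> = (\<integral>\<^sup>+v. unique_max i v \<partial>Prof)"
    using product_nn_integral_insert_rev[of ?J i "unique_max i"] insert_lessThan[OF i]
      measurable_unique_max[OF i] by simp
  finally show ?thesis .
qed

text \<open>At most one term on the left is nonzero: a coordinate equal to \<open>b\<close> rules
  out a maximum below \<open>b\<close>, and a strict maximiser is unique.\<close>

lemma Max_ge_unique_max:
  assumes v: "v \<in> space Prof"
  shows "ennreal b * indicator some_top v + (\<Sum>i<n. unique_max i v) \<le> ennreal (Max (v ` {..<n}))"
proof (cases "v \<in> some_top")
  case True
  then obtain k where k: "k < n" "v k = b" by (auto simp: some_top_def)
  have "unique_max i v = 0" if "i < n" for i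
  proof -
    have "\<not> (v i < b \<and> (\<forall>j\<in>{..<n} - {i}. v j < v i))" using k by (cases "i = k") (auto intro!: bexI[of _ k])
    then show ?thesis by (auto simp: unique_max_def indicator_def)
  qed
  moreover have "b \<le> Max (v ` {..<n})" using k by (intro Max_ge) auto
  ultimately show ?thesis using True by (simp add: ennreal_leI)
next
  case False
  have "(\<Sum>i<n. unique_max i v) \<le> ennreal (Max (v ` {..<n}))"
  proof (cases "\<exists>k<n. unique_max k v \<noteq> 0")
    case True
    then obtain k where k: "k < n" "unique_max k v \<noteq> 0" by auto
    then have less: "v j < v k" if "j < n" "j \<noteq> k" for j
      using that by (auto simp: unique_max_def indicator_def split: if_splits)
    have "unique_max i v = 0" if "i \<in> {..<n} - {k}" for i
    proof -
      have "k \<in> {..<n} - {i}" "\<not> v k < v i" using that less[of i] k(1) by auto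
      then have "\<not> (\<forall>j\<in>{..<n} - {i}. v j < v i)" by blast
      then show ?thesis by (simp add: unique_max_def)
    qed
    then have "(\<Sum>i<n. unique_max i v) = unique_max k v"
      using k(1) by (subst sum.remove[of _ k]) auto
    also have "\<dots> \<le> ennreal (v k)" by (auto simp: unique_max_def indicator_def)
    also have "\<dots> \<le> ennreal (Max (v ` {..<n}))" using k by (intro ennreal_leI Max_ge) auto
    finally show ?thesis .
  qed auto
  then show ?thesis using False by simp
qed

text \<open>Integrating the pointwise bound: the atom gives \<open>b\<close> times the probability
  of \<open>some_top\<close>, and each of the \<open>n\<close> buyers adds at least
  \<open>a * J(a / b)\<close>.\<close>

lemma expectation_Max_lower:
  "b * (1 - (1 - a / b) ^ n) + n * (a * spa_integral n (a / b)) \<le> (\<integral>v. Max (v ` {..<n}) \<partial>Prof)"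
proof -
  have c: "0 < a / b" "a / b < 1" using ab by auto
  have J: "0 \<le> a * spa_integral n (a / b)" using ab spa_integral_nonneg[OF c(1)] by simp
  have P: "0 \<le> 1 - (1 - a / b) ^ n" using c by (simp add: power_le_one)
  have sum: "(\<integral>\<^sup>+v. (\<Sum>i<n. unique_max i v) \<partial>Prof) = (\<Sum>i<n. \<integral>\<^sup>+v. unique_max i v \<partial>Prof)"
    by (rule nn_integral_sum) auto
  have "ennreal (b * (1 - (1 - a / b) ^ n) + n * (a * spa_integral n (a / b))) =
      ennreal b * emeasure Prof some_top + (\<Sum>i<n. ennreal (a * spa_integral n (a / b)))"
    using J P ab
    by (simp add: P.emeasure_eq_measure prob_some_top ennreal_mult ennreal_plus ennreal_of_nat_eq_real_of_nat)
  also have "\<dots> \<le> ennreal b * emeasure Prof some_top + (\<Sum>i<n. \<integral>\<^sup>+v. unique_max i v \<partial>Prof)"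
    by (intro add_left_mono sum_mono nn_integral_unique_max) auto
  also have "\<dots> = (\<integral>\<^sup>+v. ennreal b * indicator some_top v + (\<Sum>i<n. unique_max i v) \<partial>Prof)"
    using sum by (subst nn_integral_add) (auto simp: nn_integral_cmult_indicator)
  also have "\<dots> \<le> (\<integral>\<^sup>+v. ennreal (Max (v ` {..<n})) \<partial>Prof)"
    by (intro nn_integral_mono Max_ge_unique_max)
  also have "\<dots> = ennreal (\<integral>v. Max (v ` {..<n}) \<partial>Prof)"
  proof (rule nn_integral_eq_integral[OF integrable_Max[OF n] AE_I2])
    fix v assume "v \<in> space Prof"
    then show "0 \<le> Max (v ` {..<n})" using Max_mem[of v] n ab by (simp add: space_Prof)
  qed
  finally show ?thesis
    using expectation_Max_mem[OF n] ab by (subst (asm) ennreal_le_iff) auto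
qed

end

section \<open>Bounds on the maximin ratio\<close>

text \<open>The infimum over distributions is at most the ratio at the equal-revenue product, where
  \<open>revenue_upper\<close> bounds the numerator for all mechanisms at once. A common factor
  \<open>b\<close> cancels.\<close>

lemma maximin_ratio_upper:
  assumes n: "1 \<le> n" and ab: "0 < a" "a < b"
  defines "R \<equiv> 1 - (1 - a / b) ^ n"
  shows "maximin_ratio n a b \<le> ereal (R / (R + n * (a / b) * spa_integral n (a / b)))"
proof -
  interpret equal_revenue_profile n a b by (intro equal_revenue_profile.intro n ab)
  let ?J = "spa_integral n (a / b)" and ?E = "\<integral>v. Max (v ` {..<n}) \<partial>Prof"
  have c: "0 < a / b" "a / b < 1" using ab by auto
  have J: "0 \<le> ?J" using spa_integral_nonneg[OF c(1)] .
  have R: "0 < R" using c n by (simp add: R_def power_less_one_iff)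
  have low: "b * R + n * (a * ?J) \<le> ?E" using expectation_Max_lower by (simp add: R_def)
  moreover have "0 < b * R + n * (a * ?J)" using R J ab by (simp add: add_pos_nonneg)
  ultimately have E: "0 < ?E" by linarith
  have "Ratio n m Prof \<le> ereal (R / (R + n * (a / b) * ?J))" if m: "m \<in> M_all n a b" for m
  proof -
    have "Ratio n m Prof \<le> ereal (b * R) / ereal ?E"
      unfolding Ratio_def ext_expectation_eq_integral[OF integrable_Max[OF n]]
      using revenue_upper[OF m] E by (intro ereal_divide_right_mono) (auto simp: R_def)
    also have "\<dots> \<le> ereal (b * R / (b * R + n * (a * ?J)))"
      using low R ab \<open>0 < b * R + n * (a * ?J)\<close> E by (auto intro!: divide_left_mono)
    also have "b * R / (b * R + n * (a * ?J)) = (b * R) / (b * (R + n * (a / b) * ?J))"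
      using ab by (simp add: distrib_left)
    also have "\<dots> = R / (R + n * (a / b) * ?J)" using ab by simp
    finally show ?thesis .
  qed
  moreover have "Prof \<in> F_iid n a b"
    unfolding F_iid_def using prob_space_F sets_F by blast
  ultimately show ?thesis
    unfolding maximin_ratio_def by (intro SUP_least INF_lower2[of Prof]) auto
qed

text \<open>Always giving the item to buyer \<open>0\<close> at price \<open>a\<close>, which every
  type accepts, earns \<open>a\<close> against an expected maximum of at most \<open>b\<close>. This
  supplies the positivity of \<open>lam\<close> in \<open>k_l_less\<close>.\<close>

lemma maximin_ratio_lower:
  assumes n: "1 \<le> n" and ab: "0 < a" "a < b"
  shows "ereal (a / b) \<le> maximin_ratio n a b"
proof -
  define m :: mechanism where
    "m = (\<lambda>v i. if i = 0 then 1 else 0, \<lambda>v i. if i = 0 then a else 0)"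
  have "m \<in> M_all n a b"
    unfolding M_all_def is_mechanism_def individually_rational_def incentive_compatible_def feasible_def
      m_def
    by (auto simp: profiles_def PiE_iff sum.delta)
  moreover have "ereal (a / b) \<le> Ratio n m G" if "G \<in> F_iid n a b" for G
  proof -
    from that obtain F where F: "prob_space F" "sets F = sets (restrict_space borel {a..b})"
      and G: "G = Pi\<^sub>M {..<n} (\<lambda>_. F)"
      by (auto simp: F_iid_def)
    interpret iid_profile n a b F by (intro iid_profile.intro F)
    have rev: "(\<Sum>i<n. snd m v i) = a" for v
      using n by (simp add: m_def sum.delta)
    have "ext_expectation Prof (\<lambda>v. \<Sum>i<n. snd m v i) = ereal a"
      unfolding rev by (subst ext_expectation_eq_integral) (auto simp: P.prob_space)
    then have "Ratio n m G = ereal (a / (\<integral>v. Max (v ` {..<n}) \<partial>Prof))"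
      unfolding Ratio_def G ext_expectation_eq_integral[OF integrable_Max[OF n]]
      using expectation_Max_mem[OF n] ab by simp
    then show ?thesis
      using expectation_Max_mem[OF n] ab by (auto intro!: divide_left_mono)
  qed
  ultimately show ?thesis
    unfolding maximin_ratio_def by (intro SUP_upper2[of m] INF_greatest)
qed

theorem proposition4:
  fixes n :: nat and a b :: real
  assumes "n \<ge> 1" and "0 < a" and "a < b"
  shows "0 < maximin_ratio n a b \<and> maximin_ratio n a b \<le> 1 \<and>
         a / b > k_l (real_of_ereal (maximin_ratio n a b)) n"
proof -
  define R where "R = 1 - (1 - a / b) ^ n"
  let ?J = "spa_integral n (a / b)"
  let ?q = "R / (R + n * (a / b) * ?J)"
  have c: "0 < a / b" "a / b < 1" using assms by auto
  have J: "0 \<le> ?J" by (rule spa_integral_nonneg[OF c(1)])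
  have R: "0 < R" using c assms by (simp add: R_def power_less_one_iff)
  have "0 \<le> n * (a / b) * ?J" using J c by (intro mult_nonneg_nonneg) auto
  then have "?q \<le> 1" using R by simp
  have upper: "maximin_ratio n a b \<le> ereal ?q"
    unfolding R_def by (rule maximin_ratio_upper[OF assms])
  have lower: "ereal (a / b) \<le> maximin_ratio n a b" by (rule maximin_ratio_lower[OF assms])
  \<comment> \<open>Both bounds are finite, so the extended real is a real \<open>l\<close> and
    \<open>real_of_ereal\<close> does not fall back on its default value.\<close>
  obtain l where l: "maximin_ratio n a b = ereal l"
    using upper lower by (cases "maximin_ratio n a b") auto
  with upper lower have l': "a / b \<le> l" "l \<le> ?q" by auto
  \<comment> \<open>The condition in \<open>k_l_less\<close> is monotone in \<open>lam\<close>, so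
    the explicit bound \<open>?q\<close> can stand in for the unknown ratio
    \<open>l\<close>.\<close>
  have "l * ?J \<le> ?q * ?J" using l' J by (intro mult_right_mono)
  also have "\<dots> < (1 - a / b) ^ (n - 1)"
    unfolding R_def by (rule revenue_ratio_bound[OF assms(1) c])
  finally have "k_l l n < a / b"
    using l' c by (intro k_l_less assms) auto
  moreover have "0 < l" "l \<le> 1" using l' c \<open>?q \<le> 1\<close> by linarith+
  ultimately show ?thesis by (simp add: l)
qed

end
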